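(* Let $(\mathcal A,\varphi,\omega)$ be a cyclic non-commutative probability space and let $a,b\in\mathcal A$. Suppose that the ordered pair $(a,b)$ is cyclic-monotone independent. Then, as formal Laurent series in $1/z$, $$ \tilde{\mathfrak g}_{a+b}(z)=\tilde{\mathfrak g}_b(z)+F_b'(z)\,\tilde{\mathfrak g}_a\bigl(F_b(z)\bigr). $$
   Context: A cyclic non-commutative probability space is a triple $(\mathcal A,\varphi,\omega)$ where $\mathcal A$ is a (not necessarily unital) $*$-algebra over $\mathbb C$, $\varphi$ is a positive linear functional on $\mathcal A$, and $\omega$ is a positive tracial linear functional on $\mathcal A$ (i.e. $\omega(xy)=\omega(yx)$). Let $I$ be a totally ordered set and $\hat I=\{-\infty\}\cup I$ with $-\infty$ as minimum. An ordered family of $*$-subalgebras $\{\mathcal A_i\}_{i\in I}$ of $\mathcal A$ is cyclic-monotone independent if: (i) (monotone independence with respect to $\varphi$) for any $n\ge2$, any alternating tuple $(i_1,\dots,i_n)\in I^n$ (i.e. $i_1\ne i_2\ne\cdots\ne i_n$) and $a_k\in\mathcal A_{i_k}$, if $p\in\{1,\dots,n\}$ satisfies $i_{p-1}<i_p>i_{p+1}$ (with the conventions $i_0=i_{n+1}=-\infty$), then $\varphi(a_1\cdots a_n)=\varphi(a_p)\,\varphi(a_1\cdots a_{p-1}a_{p+1}\cdots a_n)$; (ii) for any $n\ge2$, any cyclically alternating tuple $(i_1,\dots,i_n)\in I^n$ (i.e. $i_1\ne i_2\ne\cdots\ne i_n\ne i_1$) and $a_k\in\mathcal A_{i_k}$,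 if $p\in\{1,\dots,n\}$ satisfies $i_{p-1}<i_p>i_{p+1}$ (with the conventions $i_0=i_n$, $i_{n+1}=i_1$), then $\omega(a_1\cdots a_n)=\varphi(a_p)\,\omega(a_1\cdots a_{p-1}a_{p+1}\cdots a_n)$. An ordered family of elements is cyclic-monotone independent if the ordered family of the $*$-subalgebras they generate (without unit) is; for the pair $(a,b)$ the index of $a$ is smaller than that of $b$. For $x\in\mathcal A$ define the formal Laurent series $$\tilde{\mathfrak g}_x(z)=\sum_{n=1}^\infty\frac{\omega(x^n)}{z^{n+1}},\qquad G_x(z)=\frac1z+\sum_{n=1}^\infty\frac{\varphi(x^n)}{z^{n+1}},\qquad F_x(z)=\frac1{G_x(z)}.$$ *)

theory Defs
  imports
    Complex_Main
    "HOL-Library.Option_ord"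
    "HOL-Library.Nonpos_Ints"
    "HOL-Computational_Algebra.Formal_Laurent_Series"
begin

section \<open>Non-unital $*$-algebras over the complex numbers\<close>

text \<open>The class \<^class>\<open>ring\<close> does not require a unit.\<close>

locale complex_star_algebra = vector_space scale
  for scale :: "complex \<Rightarrow> 'a::ring \<Rightarrow> 'a" +
  fixes star :: "'a \<Rightarrow> 'a"
  assumes scale_mult_left: "scale c x * y = scale c (x * y)"
    and scale_mult_right: "x * scale c y = scale c (x * y)"
    and star_add: "star (x + y) = star x + star y"
    and star_scale: "star (scale c x) = scale (cnj c) (star x)"
    and star_mult: "star (x * y) = star y * star x"
    and star_star: "star (star x) = x"

definition star_subalgebra ::
    "(complex \<Rightarrow> 'a::ring \<Rightarrow> 'a) \<Rightarrow> ('a \<Rightarrow> 'a) \<Rightarrow> 'a set \<Rightarrow> bool" where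
  "star_subalgebra scale star B \<longleftrightarrow>
     0 \<in> B \<and>
     (\<forall>x\<in>B. \<forall>y\<in>B. x + y \<in> B) \<and>
     (\<forall>c. \<forall>x\<in>B. scale c x \<in> B) \<and>
     (\<forall>x\<in>B. \<forall>y\<in>B. x * y \<in> B) \<and>
     (\<forall>x\<in>B. star x \<in> B)"

definition positive_linear_functional ::
    "(complex \<Rightarrow> 'a::ring \<Rightarrow> 'a) \<Rightarrow> ('a \<Rightarrow> 'a) \<Rightarrow> ('a \<Rightarrow> complex) \<Rightarrow> bool" where
  "positive_linear_functional scale star \<phi> \<longleftrightarrow>
     Vector_Spaces.linear scale (*) \<phi> \<and> (\<forall>x. \<phi> (star x * x) \<in> \<real>\<^sub>\<ge>\<^sub>0)"

locale cyclic_ncps = complex_star_algebra scale star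
  for scale :: "complex \<Rightarrow> 'a::ring \<Rightarrow> 'a" and star :: "'a \<Rightarrow> 'a" +
  fixes \<phi> \<omega> :: "'a \<Rightarrow> complex"
  assumes phi_positive: "positive_linear_functional scale star \<phi>"
    and omega_positive: "positive_linear_functional scale star \<omega>"
    and omega_tracial: "\<omega> (x * y) = \<omega> (y * x)"


section \<open>Cyclic-monotone independence\<close>

text \<open>
  There is no empty product without a unit; the value at the empty list is a dummy
  and only nonempty lists are used below.
\<close>

fun list_prod :: "'a::ring list \<Rightarrow> 'a" where
  "list_prod [] = 0"
| "list_prod [x] = x"
| "list_prod (x # y # xs) = x * list_prod (y # xs)"

definition delete_nth :: "nat \<Rightarrow> 'a list \<Rightarrow> 'a list" where
  "delete_nth p xs = take p xs @ drop (Suc p) xs"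

text \<open>
  A tuple is a list, so positions run from 0 to \<open>n - 1\<close>. The indices are compared in
  \<^typ>\<open>'i option\<close>, in which \<^const>\<open>None\<close> is the added minimum \<open>-\<infinity>\<close>.
\<close>

definition peak :: "'i::linorder list \<Rightarrow> nat \<Rightarrow> bool" where
  "peak js p \<longleftrightarrow>
     (if p = 0 then None else Some (js ! (p - 1))) < Some (js ! p) \<and>
     (if Suc p = length js then None else Some (js ! Suc p)) < Some (js ! p)"

definition cyclic_peak :: "'i::linorder list \<Rightarrow> nat \<Rightarrow> bool" where
  "cyclic_peak js p \<longleftrightarrow>
     (if p = 0 then last js else js ! (p - 1)) < js ! p \<and>
     (if Suc p = length js then hd js else js ! Suc p) < js ! p"

definition alternating :: "'i list \<Rightarrow> bool" where
  "alternating js \<longleftrightarrow> successively (\<noteq>) js"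

definition cyclically_alternating :: "'i list \<Rightarrow> bool" where
  "cyclically_alternating js \<longleftrightarrow> successively (\<noteq>) js \<and> last js \<noteq> hd js"

definition monotone_independent ::
    "('a::ring \<Rightarrow> complex) \<Rightarrow> 'i::linorder set \<Rightarrow> ('i \<Rightarrow> 'a set) \<Rightarrow> bool" where
  "monotone_independent \<phi> I A \<longleftrightarrow>
     (\<forall>js xs p. 2 \<le> length js \<and> set js \<subseteq> I \<and> alternating js \<and>
        list_all2 (\<lambda>x j. x \<in> A j) xs js \<and> p < length js \<and> peak js p \<longrightarrow>
        \<phi> (list_prod xs) = \<phi> (xs ! p) * \<phi> (list_prod (delete_nth p xs)))"

definition cyclic_monotone_independent ::
    "(complex \<Rightarrow> 'a::ring \<Rightarrow> 'a) \<Rightarrow> ('a \<Rightarrow> 'a) \<Rightarrow> ('a \<Rightarrow> complex) \<Rightarrow> ('a \<Rightarrow> complex) \<Rightarrow>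
     'i::linorder set \<Rightarrow> ('i \<Rightarrow> 'a set) \<Rightarrow> bool" where
  "cyclic_monotone_independent scale star \<phi> \<omega> I A \<longleftrightarrow>
     (\<forall>i\<in>I. star_subalgebra scale star (A i)) \<and>
     monotone_independent \<phi> I A \<and>
     (\<forall>js xs p. 2 \<le> length js \<and> set js \<subseteq> I \<and> cyclically_alternating js \<and>
        list_all2 (\<lambda>x j. x \<in> A j) xs js \<and> p < length js \<and> cyclic_peak js p \<longrightarrow>
        \<omega> (list_prod xs) = \<phi> (xs ! p) * \<omega> (list_prod (delete_nth p xs)))"

definition cyclic_monotone_independent_elements ::
    "(complex \<Rightarrow> 'a::ring \<Rightarrow> 'a) \<Rightarrow> ('a \<Rightarrow> 'a) \<Rightarrow> ('a \<Rightarrow> complex) \<Rightarrow> ('a \<Rightarrow> complex) \<Rightarrow>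
     'i::linorder set \<Rightarrow> ('i \<Rightarrow> 'a) \<Rightarrow> bool" where
  "cyclic_monotone_independent_elements scale star \<phi> \<omega> I x \<longleftrightarrow>
     cyclic_monotone_independent scale star \<phi> \<omega> I
       (\<lambda>i. (star_subalgebra scale star) hull {x i})"

definition cyclic_monotone_independent_pair ::
    "(complex \<Rightarrow> 'a::ring \<Rightarrow> 'a) \<Rightarrow> ('a \<Rightarrow> 'a) \<Rightarrow> ('a \<Rightarrow> complex) \<Rightarrow> ('a \<Rightarrow> complex) \<Rightarrow>
     'a \<Rightarrow> 'a \<Rightarrow> bool" where
  "cyclic_monotone_independent_pair scale star \<phi> \<omega> a b \<longleftrightarrow>
     cyclic_monotone_independent_elements scale star \<phi> \<omega> {1, 2 :: nat}
       (\<lambda>i. if i = 1 then a else b)"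


section \<open>Formal Laurent series in \<open>1/z\<close>\<close>

text \<open>
  Throughout, the indeterminate \<^const>\<open>fls_X\<close> stands for \<open>1/z\<close>, hence
  \<^const>\<open>fls_X_inv\<close> for \<open>z\<close>, and the coefficient of \<open>1/z\<^sup>m\<close> is the one with index \<open>m\<close>.
\<close>

definition moment_series :: "('a::ring \<Rightarrow> complex) \<Rightarrow> 'a \<Rightarrow> complex fls" where
  "moment_series \<mu> x =
     fls_X * fps_to_fls (Abs_fps (\<lambda>n. if n = 0 then 0 else \<mu> (list_prod (replicate n x))))"

definition g_tilde :: "('a::ring \<Rightarrow> complex) \<Rightarrow> 'a \<Rightarrow> complex fls" where
  "g_tilde \<omega> x = moment_series \<omega> x"

definition G_series :: "('a::ring \<Rightarrow> complex) \<Rightarrow> 'a \<Rightarrow> complex fls" where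
  "G_series \<phi> x = fls_X + moment_series \<phi> x"

definition F_series :: "('a::ring \<Rightarrow> complex) \<Rightarrow> 'a \<Rightarrow> complex fls" where
  "F_series \<phi> x = 1 / G_series \<phi> x"

text \<open>
  Differentiation with respect to \<open>z\<close>: for \<open>w = 1/z\<close> one has \<open>d/dz = - w\<^sup>2 d/dw\<close>.
\<close>

definition fls_deriv_z :: "complex fls \<Rightarrow> complex fls" where
  "fls_deriv_z f = - (fls_X\<^sup>2 * fls_deriv f)"

text \<open>
  Substitution of \<open>H(z)\<close> for \<open>z\<close> replaces \<open>1/z\<close> by \<open>1/H(z)\<close>. It is meaningful when \<open>H\<close> has
  positive degree in \<open>z\<close>; then \<open>1/H\<close> is a power series in \<open>1/z\<close> without constant term,
  so that \<^const>\<open>fls_regpart\<close> only changes its type.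
\<close>

definition fls_subst_z :: "complex fls \<Rightarrow> complex fls \<Rightarrow> complex fls" where
  "fls_subst_z f H = fls_compose_fps f (fls_regpart (1 / H))"

lemma fls_deriv_z_z: "fls_deriv_z fls_X_inv = 1"
proof -
  have "fls_X * fls_X_inv = (1 :: complex fls)"
    by (simp add: fls_X_times_conv_shift)
  then show ?thesis
    by (simp add: fls_deriv_z_def flip: power_mult_distrib)
qed

lemma fls_subst_z_inverse_z:
  assumes "fls_subdegree H < 0"
  shows "fls_subst_z fls_X H = 1 / H"
proof -
  have "fls_subdegree (1 / H) = - fls_subdegree H"
    by (simp add: divide_inverse fls_inverse_subdegree)
  then show ?thesis
    using assms by (simp add: fls_subst_z_def)
qed

lemma fls_nth_g_tilde:
  "fls_nth (g_tilde \<omega> x) m =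
     (if m \<ge> 2 then \<omega> (list_prod (replicate (nat (m - 1)) x)) else 0)"
  by (auto simp: g_tilde_def moment_series_def fls_X_times_conv_shift)

lemma fls_subdegree_F_series: "fls_subdegree (F_series \<phi> x) = -1"
proof -
  have "fls_subdegree (G_series \<phi> x) = 1"
    by (rule fls_subdegree_eqI)
       (auto simp: G_series_def moment_series_def fls_X_times_conv_shift)
  then show ?thesis
    by (simp add: F_series_def divide_inverse fls_inverse_subdegree)
qed

end

theory Submission
  imports Defs
begin

text \<open>
  Write \<open>w = 1/z\<close>, \<open>m\<^sub>0 = 1\<close>, \<open>m\<^sub>r = \<phi>(b\<^sup>r)\<close> and \<open>P(w) = \<Sum>\<^sub>r m\<^sub>r w\<^bsup>r+1\<^esup>\<close>. Then \<open>G\<^sub>b = P\<close>,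
  \<open>F\<^sub>b = 1/P\<close>, and \<open>F\<^sub>b' = w\<^sup>2 P'(w) / P(w)\<^sup>2\<close>, the dash on the right being \<open>d/dw\<close>. Since
  \<open>g\<^sub>a\<close> starts with \<open>1/z\<^sup>2\<close>, substituting \<open>F\<^sub>b\<close> in it produces a factor \<open>P\<^sup>2\<close> which cancels the
  denominator. So the claim amounts to the identity of power series
  \<open>\<Sum>\<^sub>n \<omega>((a+b)\<^bsup>n+1\<^esup>) w\<^sup>n = \<Sum>\<^sub>n \<omega>(b\<^bsup>n+1\<^esup>) w\<^sup>n + P'(w) \<Sum>\<^sub>k \<omega>(a\<^bsup>k+1\<^esup>) P(w)\<^sup>k\<close>
  (\<open>omega_generating_function\<close>).

  To prove it, expand \<open>(a+b)\<^bsup>n+1\<^esup>\<close> into words. A word that contains \<open>a\<close> has the form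
  \<open>b\<^sup>i a b\<^bsup>r\<^sub>1\<^esup> a \<dots> b\<^bsup>r\<^sub>k\<^esup> a b\<^sup>j\<close>. Read cyclically, all its blocks of \<open>b\<close>'s are peaks, the outer two
  forming a single block \<open>b\<^bsup>i+j\<^esup>\<close>. Hence \<open>\<omega>\<close> of the word is
  \<open>m\<^bsub>i+j\<^esub> m\<^bsub>r\<^sub>1\<^esub> \<dots> m\<^bsub>r\<^sub>k\<^esub> \<omega>(a\<^bsup>k+1\<^esup>)\<close>. There are \<open>q + 1\<close> ways to write \<open>q = i + j\<close>, so the outer block
  contributes \<open>\<Sum>\<^sub>q (q+1) m\<^sub>q w\<^sup>q = P'(w)\<close>; each inner gap, together with one letter \<open>a\<close>,
  contributes a factor \<open>P(w)\<close>.

  The peak removal is \<open>bordered_sum_factor\<close>. It is applied to sums of words and not to single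
  words, which keeps the sums over \<open>r\<^sub>1, \<dots>, r\<^sub>k\<close> implicit: \<open>omega_pos_power_sum\<close> treats the outer
  block, and the inner gaps are removed one at a time by a recursion over the number of letters
  \<open>a\<close> already in front (\<open>framed_generating_function\<close>).
\<close>


section \<open>Powers in a ring without unit\<close>

text \<open>
  Without a unit \<open>x\<^sup>0\<close> is not an element of the ring, but multiplication by \<open>x\<^sup>0\<close> still is an
  operation. Gaps of length \<open>0\<close> between letters are therefore expressed by iterated
  multiplication, and genuine powers have their exponent shifted by one.
\<close>

abbreviation left_power :: "'a::ring \<Rightarrow> nat \<Rightarrow> 'a \<Rightarrow> 'a" where
  "left_power x n \<equiv> ((*) x) ^^ n"

abbreviation right_power :: "'a::ring \<Rightarrow> nat \<Rightarrow> 'a \<Rightarrow> 'a" where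
  "right_power x n \<equiv> (\<lambda>y. y * x) ^^ n"

abbreviation pos_power :: "'a::ring \<Rightarrow> nat \<Rightarrow> 'a" where
  "pos_power x n \<equiv> list_prod (replicate (Suc n) x)"

lemma list_prod_Cons: "xs \<noteq> [] \<Longrightarrow> list_prod (x # xs) = x * list_prod xs"
  by (cases xs) auto

lemma list_prod_append:
  "xs \<noteq> [] \<Longrightarrow> ys \<noteq> [] \<Longrightarrow> list_prod (xs @ ys) = list_prod xs * list_prod ys"
proof (induction xs)
  case (Cons x xs)
  then show ?case
    by (cases "xs = []") (auto simp: list_prod_Cons mult.assoc)
qed simp

lemma pos_power_Suc_right: "pos_power x (Suc n) = pos_power x n * x"
  using list_prod_append[of "replicate (Suc n) x" "[x]"]
  by (simp add: replicate_append_same del: list_prod.simps(3))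

lemma left_power_Suc_eq: "left_power x (Suc n) y = pos_power x n * y"
  by (induction n) (auto simp: mult.assoc)

lemma right_power_Suc_eq: "right_power x (Suc n) y = y * pos_power x n"
proof (induction n)
  case (Suc n)
  then show ?case
    unfolding pos_power_Suc_right by (simp add: mult.assoc)
qed simp

lemma pos_power_eq_left_power: "pos_power x n = left_power x n x"
  by (induction n) auto

lemma left_power_sum: "left_power x n (sum f S) = (\<Sum>i\<in>S. left_power x n (f i))"
  by (induction n) (auto simp: sum_distrib_left)


section \<open>Expanding a power of a sum\<close>

text \<open>
  The sum of all words of length \<open>l + 1\<close> in \<open>a\<close> and \<open>b\<close> whose first and last letter is \<open>a\<close>; for
  \<open>l = 0\<close> these two letters coincide.
\<close>

primrec framed :: "'a::ring \<Rightarrow> 'a \<Rightarrow> nat \<Rightarrow> 'a" where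
  "framed a b 0 = a"
| "framed a b (Suc l) = a * left_power (a + b) l a"

text \<open>
  A word ending in \<open>a\<close> is sorted by the number \<open>r\<close> of letters \<open>b\<close> before its first \<open>a\<close>.
\<close>

lemma left_power_expand_first:
  "left_power (a + b) m a = (\<Sum>r\<le>m. left_power b r (framed a b (m - r)))"
proof (induction m)
  case (Suc m)
  have "left_power (a + b) (Suc m) a = framed a b (Suc m) + b * left_power (a + b) m a"
    by (simp add: distrib_right)
  also have "\<dots> = framed a b (Suc m) + (\<Sum>r\<le>m. left_power b (Suc r) (framed a b (m - r)))"
    unfolding Suc.IH by (simp add: sum_distrib_left)
  also have "\<dots> = (\<Sum>r\<le>Suc m. left_power b r (framed a b (Suc m - r)))"
    unfolding sum.atMost_Suc_shift by (simp del: framed.simps)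
  finally show ?case .
qed simp

text \<open>
  A word containing \<open>a\<close> is sorted by the number \<open>j\<close> of letters \<open>b\<close> after its last \<open>a\<close>. Together
  with the expansion by the first \<open>a\<close>, this isolates the outer block of \<open>b\<close>'s.
\<close>

lemma pos_power_expand_last:
  "pos_power (a + b) n =
     pos_power b n + (\<Sum>j\<le>n. right_power b j (left_power (a + b) (n - j) a))"
proof (induction n)
  case (Suc n)
  have "pos_power (a + b) (Suc n) = pos_power (a + b) n * a + pos_power (a + b) n * b"
    unfolding pos_power_Suc_right by (simp only: distrib_left)
  also have "pos_power (a + b) n * a = left_power (a + b) (Suc n) a"
    by (simp only: left_power_Suc_eq)
  also have "pos_power (a + b) n * b =
      pos_power b (Suc n) + (\<Sum>j\<le>n. right_power b (Suc j) (left_power (a + b) (n - j) a))"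
    unfolding Suc.IH pos_power_Suc_right
    by (simp only: distrib_right sum_distrib_right funpow.simps o_apply)
  finally show ?case
    unfolding sum.atMost_Suc_shift by (simp only: diff_zero diff_Suc_Suc funpow_0 add_ac)
qed simp


section \<open>Bordered words\<close>

text \<open>
  Alternating products that begin and end with a factor from \<open>A\<close>. Appending a factor from \<open>B\<close>
  makes such a product cyclically alternating, with that factor as a peak if \<open>B\<close> has the larger
  index. Adding two factors at a time keeps the alternation without a record of the indices.
\<close>

inductive_set bordered :: "'a::ring set \<Rightarrow> 'a set \<Rightarrow> 'a set" for A B where
  base: "x \<in> A \<Longrightarrow> x \<in> bordered A B"
| step: "v \<in> bordered A B \<Longrightarrow> y \<in> B \<Longrightarrow> x \<in> A \<Longrightarrow> v * y * x \<in> bordered A B"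

text \<open>
  The new factor is merged with the last one, so the product stays alternating.
\<close>

lemma bordered_mult_right:
  assumes "\<And>x y. x \<in> A \<Longrightarrow> y \<in> A \<Longrightarrow> x * y \<in> A" "v \<in> bordered A B" "x \<in> A"
  shows "v * x \<in> bordered A B"
  using assms(2)
proof cases
  case base
  then show ?thesis using assms by (auto intro: bordered.base)
next
  case (step v' y x')
  then show ?thesis
    using assms bordered.step[of v' A B y "x' * x"] by (simp add: mult.assoc)
qed

lemma bordered_factorization:
  assumes "v \<in> bordered (A i) (A j)" "i \<noteq> j"
  obtains xs js where "js \<noteq> []" "hd js = i" "last js = i" "set js \<subseteq> {i, j}" "alternating js"
    "list_all2 (\<lambda>x k. x \<in> A k) xs js" "list_prod xs = v"
proof -
  have "\<exists>xs js. js \<noteq> [] \<and> hd js = i \<and> last js = i \<and> set js \<subseteq> {i, j} \<and> alternating js \<and>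
      list_all2 (\<lambda>x k. x \<in> A k) xs js \<and> list_prod xs = v"
    using assms(1)
  proof induction
    case (base x)
    then show ?case
      by (intro exI[of _ "[x]"] exI[of _ "[i]"]) (auto simp: alternating_def)
  next
    case (step v y x)
    then obtain xs js where *: "js \<noteq> []" "hd js = i" "last js = i" "set js \<subseteq> {i, j}"
      "alternating js" "list_all2 (\<lambda>x k. x \<in> A k) xs js" "list_prod xs = v"
      by blast
    have "xs \<noteq> []" using * by auto
    then show ?case using * step assms(2)
      by (intro exI[of _ "xs @ [y, x]"] exI[of _ "js @ [j, i]"])
         (auto simp: alternating_def successively_append_iff list_prod_append
            list_all2_append mult.assoc list_all2_lengthD)
  qed
  then show ?thesis using that by blast
qed

text \<open>
  The cyclic condition is applied at the last position: the neighbours of \<open>y\<close> on the circle are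
  the last and the first factor of \<open>v\<close>, both of index \<open>i < j\<close>.
\<close>

lemma cyclic_monotone_bordered:
  assumes "cyclic_monotone_independent scale star \<phi> \<omega> I A" "i \<in> I" "j \<in> I" "i < j"
    and "v \<in> bordered (A i) (A j)" "y \<in> A j"
  shows "\<omega> (v * y) = \<phi> y * \<omega> v"
proof -
  obtain xs js where *: "js \<noteq> []" "hd js = i" "last js = i" "set js \<subseteq> {i, j}" "alternating js"
    "list_all2 (\<lambda>x k. x \<in> A k) xs js" "list_prod xs = v"
    using bordered_factorization assms by (metis less_irrefl)
  let ?js = "js @ [j]" and ?xs = "xs @ [y]" and ?p = "length js"
  have len: "length xs = length js" and xs: "xs \<noteq> []"
    using * by (auto dest: list_all2_lengthD)
  have "2 \<le> length ?js" "set ?js \<subseteq> I" "?p < length ?js"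
    using * assms by (auto simp: Suc_le_eq)
  moreover have "cyclically_alternating ?js" "cyclic_peak ?js ?p"
    using * assms
    by (auto simp: cyclically_alternating_def alternating_def successively_append_iff
        cyclic_peak_def nth_append last_conv_nth)
  moreover have "list_all2 (\<lambda>x k. x \<in> A k) ?xs ?js"
    using * assms len by (auto simp: list_all2_append)
  ultimately have "\<omega> (list_prod ?xs) = \<phi> (?xs ! ?p) * \<omega> (list_prod (delete_nth ?p ?xs))"
    using assms(1) unfolding cyclic_monotone_independent_def by blast
  then show ?thesis
    using * xs by (simp add: delete_nth_def list_prod_append nth_append flip: len)
qed


section \<open>Peak removal and the moments of the sum\<close>

locale cyclic_monotone_pair = cyclic_ncps scale star \<phi> \<omega>
  for scale :: "complex \<Rightarrow> 'a::ring \<Rightarrow> 'a" and star and \<phi> \<omega> :: "'a \<Rightarrow> complex" +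
  fixes a b :: 'a
  assumes independent: "cyclic_monotone_independent_pair scale star \<phi> \<omega> a b"
begin

sublocale omega: Vector_Spaces.linear scale "(*)" \<omega>
  using omega_positive by (simp add: positive_linear_functional_def)

abbreviation "A \<equiv> (star_subalgebra scale star) hull {a}"
abbreviation "B \<equiv> (star_subalgebra scale star) hull {b}"

lemma subalgebras: "star_subalgebra scale star A" "star_subalgebra scale star B"
  and bordered_factor: "v \<in> bordered A B \<Longrightarrow> y \<in> B \<Longrightarrow> \<omega> (v * y) = \<phi> y * \<omega> v"
proof -
  let ?C = "\<lambda>i::nat. (star_subalgebra scale star) hull {if i = 1 then a else b}"
  have *: "cyclic_monotone_independent scale star \<phi> \<omega> {1, 2} ?C"
    using independent
    by (simp add: cyclic_monotone_independent_pair_def cyclic_monotone_independent_elements_def)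
  then show "star_subalgebra scale star A" "star_subalgebra scale star B"
    by (auto simp: cyclic_monotone_independent_def)
  show "\<omega> (v * y) = \<phi> y * \<omega> v" if "v \<in> bordered A B" "y \<in> B"
    using cyclic_monotone_bordered[OF *, of 1 2 v y] that by simp
qed

lemma generators: "a \<in> A" "b \<in> B"
  by (simp_all add: hull_inc)

lemma mult_closed: "x \<in> A \<Longrightarrow> x' \<in> A \<Longrightarrow> x * x' \<in> A" "y \<in> B \<Longrightarrow> y' \<in> B \<Longrightarrow> y * y' \<in> B"
  using subalgebras by (auto simp: star_subalgebra_def)

lemma pos_power_closed: "pos_power a n \<in> A" "pos_power b n \<in> B"
proof -
  show "pos_power a n \<in> A"
    by (induction n) (use generators mult_closed in auto)
  show "pos_power b n \<in> B"
    by (induction n) (use generators mult_closed in auto)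
qed

text \<open>
  The products \<open>v (a+b)\<^sup>l x\<close> are sums of bordered words, and the factorization is additive in the
  first factor. Splitting off one letter of \<open>(a+b)\<^sup>l\<close> either extends the bordered word by \<open>a\<close> or
  opens a block of \<open>b\<close>'s; the second claim, with a pending block \<open>y\<close>, makes the induction close.
\<close>

lemma bordered_sum_factor:
  assumes "v \<in> bordered A B" "y \<in> B" "x \<in> A" "y' \<in> B"
  shows "\<omega> (v * left_power (a + b) l x * y') = \<phi> y' * \<omega> (v * left_power (a + b) l x)"
    and "\<omega> (v * y * left_power (a + b) l x * y') = \<phi> y' * \<omega> (v * y * left_power (a + b) l x)"
  using assms
proof (induction l arbitrary: v y)
  case 0
  note mult_right = bordered_mult_right[OF mult_closed(1)]
  {
    case 1
    then show ?case using mult_right bordered_factor by simp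
  next
    case 2
    then show ?case using bordered.step[of v A B y x] bordered_factor by simp
  }
next
  case (Suc l)
  note mult_right = bordered_mult_right[OF mult_closed(1)]
  {
    case 1
    then have "v * a \<in> bordered A B" using mult_right generators by blast
    then show ?case
      using Suc.IH(1)[of "v * a" b] Suc.IH(2)[of v b] 1 generators
      by (simp add: distrib_left distrib_right mult.assoc omega.add)
  next
    case 2
    then have "v * y * a \<in> bordered A B" "y * b \<in> B"
      using bordered.step generators mult_closed by blast+
    then show ?case
      using Suc.IH(1)[of "v * y * a" b] Suc.IH(2)[of v "y * b"] 2 generators
      by (simp add: distrib_left distrib_right mult.assoc omega.add)
  }
qed

text \<open>
  The value \<open>1\<close> at \<open>0\<close> accounts for an empty gap between two letters \<open>a\<close>.
\<close>

definition b_moment :: "nat \<Rightarrow> complex" where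
  "b_moment r = (if r = 0 then 1 else \<phi> (list_prod (replicate r b)))"

lemma omega_rotate: "\<omega> (right_power x n y) = \<omega> (left_power x n y)"
proof (cases n)
  case (Suc m)
  then show ?thesis
    by (simp only: left_power_Suc_eq right_power_Suc_eq omega_tracial)
qed simp

lemma framed_mult_factor:
  assumes "x \<in> A" "y \<in> B"
  shows "\<omega> (framed a b l * x * y) = \<phi> y * \<omega> (framed a b l * x)"
proof (cases l)
  case 0
  then show ?thesis
    using assms bordered_factor[of "a * x" y] bordered.base[of "a * x" A B] generators mult_closed
    by simp
next
  case (Suc m)
  have "left_power (a + b) m a * x = left_power (a + b) m (a * x)"
    by (induction m) (auto simp: mult.assoc)
  then show ?thesis
    using assms bordered_sum_factor(1)[of a y "a * x" y m] bordered.base[of a A B]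
      generators mult_closed Suc
    by (simp add: mult.assoc)
qed

lemma framed_factor: "y \<in> B \<Longrightarrow> \<omega> (framed a b l * y) = \<phi> y * \<omega> (framed a b l)"
  using bordered_factor[of a y] bordered_sum_factor(1)[of a y a y] bordered.base[of a A B] generators
  by (cases l) auto

text \<open>
  The gap \<open>b\<^sup>r\<close> is a peak between \<open>a\<^sup>k\<close> and the letter \<open>a\<close> that starts \<open>framed a b l\<close>. To see this,
  rotate the word so that the gap comes last; the last letter \<open>a\<close> of \<open>framed a b l\<close> then absorbs
  \<open>a\<^sup>k\<close>. For \<open>k = 0\<close> the gap lies, on the circle, between the two ends of \<open>framed a b l\<close>.
\<close>

lemma omega_collapse_gap:
  "\<omega> (left_power a k (left_power b r (framed a b l))) =
     b_moment r * \<omega> (left_power a k (framed a b l))"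
proof (cases r)
  case 0
  then show ?thesis by (simp add: b_moment_def)
next
  case (Suc r')
  let ?v = "framed a b l" and ?y = "pos_power b r'"
  have y: "?y \<in> B" by (rule pos_power_closed)
  have "\<omega> (left_power a k (?y * ?v)) = \<phi> ?y * \<omega> (left_power a k ?v)"
  proof (cases k)
    case 0
    then show ?thesis
      using framed_factor[OF y, of l] omega_tracial[of ?v ?y] by simp
  next
    case (Suc k')
    let ?x = "pos_power a k'"
    have "\<omega> (?x * (?y * ?v)) = \<omega> (?v * ?x * ?y)"
      using omega_tracial[of "?x * ?y" ?v] by (simp only: mult.assoc)
    also have "\<dots> = \<phi> ?y * \<omega> (?v * ?x)"
      by (rule framed_mult_factor[OF pos_power_closed(1) y])
    also have "\<omega> (?v * ?x) = \<omega> (?x * ?v)"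
      by (rule omega_tracial)
    finally show ?thesis
      unfolding Suc left_power_Suc_eq .
  qed
  then show ?thesis
    by (simp only: Suc left_power_Suc_eq b_moment_def nat.distinct if_False)
qed

text \<open>
  For a fixed word \<open>v\<close> of \<open>framed a b (n - q)\<close>, the words \<open>b\<^sup>r v b\<^sup>j\<close> with \<open>j + r = q\<close> all have the same
  value, since under the trace only the length \<open>q\<close> of the joined outer block matters. The factor
  \<open>q + 1\<close> counts the ways to split that block.
\<close>

lemma omega_pos_power_sum:
  "\<omega> (pos_power (a + b) n) =
     \<omega> (pos_power b n) + (\<Sum>q\<le>n. of_nat (q + 1) * b_moment q * \<omega> (framed a b (n - q)))"
proof -
  have "\<omega> (left_power b j (left_power b r (framed a b l))) = b_moment (j + r) * \<omega> (framed a b l)"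
    for j r l
    using omega_collapse_gap[of 0 "j + r" l] by (simp add: funpow_add)
  then have inner: "\<omega> (right_power b j (left_power (a + b) (n - j) a)) =
      (\<Sum>r\<le>n - j. b_moment (j + r) * \<omega> (framed a b (n - (j + r))))" for j
    unfolding omega_rotate left_power_expand_first left_power_sum omega.sum
    by simp
  have "(\<Sum>j\<le>n. \<Sum>r\<le>n - j. b_moment (j + r) * \<omega> (framed a b (n - (j + r)))) =
      (\<Sum>(j, r)\<in>{(j, r). j + r \<le> n}. b_moment (j + r) * \<omega> (framed a b (n - (j + r))))"
    by (subst sum.Sigma) (auto intro!: sum.cong)
  also have "\<dots> = (\<Sum>q\<le>n. \<Sum>j\<le>q. b_moment q * \<omega> (framed a b (n - q)))"
    unfolding sum.triangle_reindex_eq by (intro sum.cong) auto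
  also have "\<dots> = (\<Sum>q\<le>n. of_nat (q + 1) * b_moment q * \<omega> (framed a b (n - q)))"
    by (simp only: sum_constant card_atMost Suc_eq_plus1 mult.assoc)
  finally show ?thesis
    by (subst pos_power_expand_last) (simp only: omega.add omega.sum inner)
qed

end


section \<open>Generating functions\<close>

text \<open>
  Unfolding the recursion gives \<open>S 0 = \<alpha> 0 + \<alpha> 1 P + \<alpha> 2 P\<^sup>2 + \<dots>\<close>. The shifted series
  \<open>(\<Sum>\<^sub>n \<alpha> (k + n) X\<^sup>n) oo P\<close> satisfy the same recursion, and the solution is unique because \<open>P\<close> has
  no constant term: each coefficient of a difference of solutions depends only on lower
  coefficients of the next one.
\<close>

lemma fps_compose_by_recursion:
  fixes S :: "nat \<Rightarrow> 'a::field fps"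
  assumes P0: "fps_nth P 0 = 0"
    and S: "\<And>k. S k = fps_const (\<alpha> k) + P * S (Suc k)"
  shows "S 0 = Abs_fps \<alpha> oo P"
proof -
  define T where "T k = Abs_fps (\<lambda>n. \<alpha> (k + n)) oo P" for k
  have T: "T k = fps_const (\<alpha> k) + P * T (Suc k)" for k
  proof -
    have "Abs_fps (\<lambda>n. \<alpha> (k + n)) = fps_const (\<alpha> k) + fps_X * Abs_fps (\<lambda>n. \<alpha> (Suc k + n))"
      by (rule fps_ext) (auto simp: fps_X_mult_nth split: nat.splits)
    then show ?thesis
      using P0 by (simp add: T_def fps_compose_add_distrib fps_compose_mult_distrib)
  qed
  have "fps_nth (S k - T k) n = 0" for k n
  proof (induction n arbitrary: k rule: less_induct)
    case (less n)
    have "S k - T k = P * (S (Suc k) - T (Suc k))"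
      unfolding S[of k] T[of k] by (simp add: algebra_simps)
    moreover have "fps_nth P i * fps_nth (S (Suc k) - T (Suc k)) (n - i) = 0"
      if "i \<le> n" for i
      using that P0 less.IH[of "n - i" "Suc k"] by (cases "i = 0") auto
    ultimately show ?case
      by (simp only: fps_mult_nth) (rule sum.neutral, simp del: fps_sub_nth mult_eq_0_iff)
  qed
  then have "S 0 = T 0" by (simp add: fps_eq_iff)
  then show ?thesis by (simp add: T_def)
qed

text \<open>
  With \<open>w = 1/z\<close> and \<open>F = 1/P\<close>, the chain rule gives \<open>dF/dz = w\<^sup>2 P' / P\<^sup>2\<close>, and the two factors \<open>w\<close> of
  \<open>w\<^sup>2 f(w)\<close> become \<open>P\<^sup>2\<close> under the substitution.
\<close>

lemma fls_deriv_inverse_substitution: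
  fixes P f :: "complex fps"
  assumes "P \<noteq> 0" "fps_nth P 0 = 0"
  shows "fls_deriv_z (1 / fps_to_fls P) * fls_subst_z (fps_to_fls (fps_X\<^sup>2 * f)) (1 / fps_to_fls P) =
    fps_to_fls (fps_X\<^sup>2 * (fps_deriv P * (f oo P)))"
proof -
  have nz: "fps_to_fls P \<noteq> 0" using assms by simp
  have "fls_deriv_z (1 / fps_to_fls P) = fls_X\<^sup>2 * fps_to_fls (fps_deriv P) / fps_to_fls P ^ 2"
    using nz by (simp add: fls_deriv_z_def fls_deriv_fps_to_fls fls_inverse_deriv
        divide_inverse power2_eq_square)
  moreover have "fls_subst_z (fps_to_fls (fps_X\<^sup>2 * f)) (1 / fps_to_fls P) =
      fps_to_fls ((fps_X\<^sup>2 * f) oo P)"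
    unfolding fls_subst_z_def using assms by (subst fls_compose_fps_to_fls) simp_all
  moreover have "(fps_X\<^sup>2 * f) oo P = P\<^sup>2 * (f oo P)"
    using assms by (simp add: fps_compose_mult_distrib power2_eq_square)
  ultimately show ?thesis
    using nz by (simp add: fls_times_fps_to_fls fps_to_fls_power)
qed

lemma moment_series_eq:
  "moment_series \<mu> x = fps_to_fls (fps_X\<^sup>2 * Abs_fps (\<lambda>n. \<mu> (pos_power x n)))"
proof -
  have "Abs_fps (\<lambda>n. if n = 0 then 0 else \<mu> (list_prod (replicate n x))) =
      fps_X * Abs_fps (\<lambda>n. \<mu> (pos_power x n))"
    by (rule fps_ext) (auto simp: fps_X_mult_nth gr0_conv_Suc)
  then show ?thesis
    by (simp only: moment_series_def power2_eq_square fls_times_fps_to_fls mult.assoc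
        fps_X_to_fls)
qed

context cyclic_monotone_pair
begin

definition b_cauchy :: "complex fps" where
  "b_cauchy = fps_X * Abs_fps b_moment"

lemma G_series_b: "G_series \<phi> b = fps_to_fls b_cauchy"
proof -
  have "Abs_fps b_moment = 1 + fps_X * Abs_fps (\<lambda>n. \<phi> (pos_power b n))"
    by (rule fps_ext) (auto simp: b_moment_def fps_X_mult_nth gr0_conv_Suc)
  then show ?thesis
    by (simp add: G_series_def moment_series_eq b_cauchy_def algebra_simps power2_eq_square
        fls_times_fps_to_fls)
qed

lemma b_cauchy_nth_0: "fps_nth b_cauchy 0 = 0"
  and b_cauchy_nonzero: "b_cauchy \<noteq> 0"
proof -
  show "fps_nth b_cauchy 0 = 0" by (simp add: b_cauchy_def)
  have "fps_nth b_cauchy 1 = 1" by (simp add: b_cauchy_def b_moment_def)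
  then show "b_cauchy \<noteq> 0" by auto
qed

lemma fps_deriv_b_cauchy: "fps_deriv b_cauchy = Abs_fps (\<lambda>q. of_nat (q + 1) * b_moment q)"
  by (rule fps_ext) (simp add: b_cauchy_def distrib_right)

text \<open>
  With \<open>k\<close> letters \<open>a\<close> in front, a word of \<open>framed a b (m + 1)\<close> is \<open>a b\<^sup>r\<close> followed by a word of
  \<open>framed a b (m - r)\<close>; collapsing the gap leaves a factor \<open>m\<^sub>r\<close> and \<open>k + 1\<close> letters in front. In
  generating functions this is the recursion \<open>S\<^sub>k = \<omega>(a\<^bsup>k+1\<^esup>) + P S\<^bsub>k+1\<^esub>\<close>, where \<open>m\<^sub>r = b_moment r\<close>
  and \<open>P = b_cauchy\<close>.
\<close>

lemma framed_generating_function: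
  "Abs_fps (\<lambda>l. \<omega> (framed a b l)) = Abs_fps (\<lambda>k. \<omega> (pos_power a k)) oo b_cauchy"
proof -
  define S where "S k = Abs_fps (\<lambda>l. \<omega> (left_power a k (framed a b l)))" for k
  have "S k = fps_const (\<omega> (pos_power a k)) + b_cauchy * S (Suc k)" for k
  proof (rule fps_ext)
    fix n
    show "fps_nth (S k) n = fps_nth (fps_const (\<omega> (pos_power a k)) + b_cauchy * S (Suc k)) n"
    proof (cases n)
      case 0
      then show ?thesis by (simp add: S_def b_cauchy_def mult.assoc pos_power_eq_left_power
            del: replicate.simps)
    next
      case (Suc m)
      have "left_power a k (framed a b (Suc m)) =
          (\<Sum>r\<le>m. left_power a (Suc k) (left_power b r (framed a b (m - r))))"
        by (simp add: left_power_expand_first left_power_sum sum_distrib_left funpow_swap1)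
      then have "fps_nth (S k) n =
          (\<Sum>r\<le>m. b_moment r * \<omega> (left_power a (Suc k) (framed a b (m - r))))"
        by (simp only: S_def Suc fps_nth_Abs_fps omega.sum omega_collapse_gap)
      also have "\<dots> = fps_nth (Abs_fps b_moment * S (Suc k)) m"
        by (simp only: fps_mult_nth S_def atLeast0AtMost fps_nth_Abs_fps)
      also have "\<dots> = fps_nth (b_cauchy * S (Suc k)) n"
        by (simp add: b_cauchy_def mult.assoc Suc)
      finally show ?thesis by (simp add: Suc)
    qed
  qed
  then show ?thesis
    using fps_compose_by_recursion[of b_cauchy S "\<lambda>k. \<omega> (pos_power a k)"] b_cauchy_nth_0
    by (simp add: S_def)
qed

lemma omega_generating_function:
  "Abs_fps (\<lambda>n. \<omega> (pos_power (a + b) n)) =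
     Abs_fps (\<lambda>n. \<omega> (pos_power b n)) +
     fps_deriv b_cauchy * (Abs_fps (\<lambda>k. \<omega> (pos_power a k)) oo b_cauchy)"
  by (rule fps_ext)
     (simp add: omega_pos_power_sum fps_deriv_b_cauchy fps_mult_nth atLeast0AtMost
        flip: framed_generating_function del: replicate.simps)

end

theorem theorem7p6:
  fixes scale :: "complex \<Rightarrow> 'a::ring \<Rightarrow> 'a" and star :: "'a \<Rightarrow> 'a"
    and \<phi> \<omega> :: "'a \<Rightarrow> complex" and a b :: 'a
  assumes "cyclic_ncps scale star \<phi> \<omega>"
    and "cyclic_monotone_independent_pair scale star \<phi> \<omega> a b"
  shows "g_tilde \<omega> (a + b) =
    g_tilde \<omega> b + fls_deriv_z (F_series \<phi> b) * fls_subst_z (g_tilde \<omega> a) (F_series \<phi> b)"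
proof -
  interpret cyclic_monotone_pair scale star \<phi> \<omega> a b
    by (intro cyclic_monotone_pair.intro cyclic_monotone_pair_axioms.intro assms)
  show ?thesis
    unfolding g_tilde_def F_series_def G_series_b moment_series_eq
      fls_deriv_inverse_substitution[OF b_cauchy_nonzero b_cauchy_nth_0]
      omega_generating_function
    by (simp only: distrib_left fps_to_fls_plus)
qed

end
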